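(* For all integers $t\ge1$ and $m\ge0$, the distribution $p_m(t)=\mathbb{P}(N(t)=m)$ of the number of customers in the discrete-time D-BMAP/G/$\infty$ queue is $$p_m(t)=\frac1{m!}\;\mathbf{p}_0\sum_{\substack{l_0+l_1+\cdots+l_{t-1}=m\\ l_i\ge0}}\frac{m!}{l_0!\,l_1!\cdots l_{t-1}!}\prod_{i=0}^{t-1}\Phi(t-i)^{l_i}D^{(l_i)}\bigl(1-\Phi(t-i)\bigr)\,\bm{1}^T,$$ and, for every integer $k\ge1$, the $k$-th factorial moment $\mu_k(t)=\sum_{m\ge0}m(m-1)\cdots(m-k+1)\,p_m(t)$ is $$\mu_k(t)=\mathbf{p}_0\sum_{\substack{l_0+l_1+\cdots+l_{t-1}=k\\ l_i\ge0}}\frac{k!}{l_0!\,l_1!\cdots l_{t-1}!}\prod_{i=0}^{t-1}\Phi(t-i)^{l_i}D^{(l_i)}(1)\,\bm{1}^T,$$ where all matrix products are ordered from left to right by increasing $i$ (from $i=0$ to $i=t-1$).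
   Context: Discrete-time D-BMAP/G/$\infty$ queue. Time is $0,1,2,\dots$. The arrival process is a discrete-time batch Markovian arrival process (D-BMAP): there is a background Markov chain $(I(t))_{t\ge 0}$ with state space $\{1,2,\dots\}$ and nonnegative matrices $\mathbf{D}_l=(d_{ij}(l))_{i,j\ge 1}$, $l=0,1,2,\dots$, with $\sum_{j\ge1}\sum_{l\ge0}d_{ij}(l)=1$ for each $i$. Given $I(k)=i$ (and independently of the past before time $k$ given $I(k)$), with probability $d_{ij}(l)$ one has $I(k+1)=j$ and exactly $l$ customers arrive along with the transition from $I(k)$ to $I(k+1)$; these customers are assigned arrival time $\tau=k$. $D(z)=\sum_{l\ge0}\mathbf{D}_lz^l$, and $D^{(l)}(x)$ denotes the entrywise $l$-th derivative, i.e. the matrix with entries $\sum_{r\ge l}r(r-1)\cdots(r-l+1)\,d_{ij}(r)\,x^{r-l}$ for $x\in[0,1]$ (with $x^0=1$). All quantities are nonnegative and are understood in $[0,\infty]$; the conventions $0^0=1$ and $0\cdot\infty=0$ are used (in particular, if $\Phi(t-i)=0$ and $l_i\ge1$ the factor $\Phi(t-i)^{l_i}D^{(l_i)}(\cdot)$ is the zero matrix). There are infinitely many servers: each customer starts service immediately upon arrival. Service times are i.i.d. copies of a random variable $Y$ with values in $\{1,2,\dots\}$ (arbitrary distribution) and are independent of the background chain and the batch arrivals. $\Phi(t)=\mathbb{P}(Y>t)$. A customer with arrival time $\tau$ and service time $Y$ is no longer counted from time $\tau+Y$ on. There are no customers at time $0$. $N(t)$ is the number of customers in the system at time $t$: the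 number of customers that arrived along with one of the first $t$ transitions (those from time $k$ to $k+1$ with $0\le k\le t-1$, arrival time $\tau=k$) and whose service time $Y$ satisfies $\tau+Y>t$; in particular $N(0)=0$. $\mathbf{p}_0=(\mathbb{P}(I(0)=1),\mathbb{P}(I(0)=2),\dots)$ is the initial distribution of the background chain (a row vector), and $\bm{1}$ is the row vector with all entries $1$. *)

theory Defs
  imports "HOL-Probability.Probability"
begin

text \<open>
  The background chain has state space \<open>{1, 2, \<dots>}\<close>, rendered as \<open>{1..} :: nat set\<close>. Vectors and
  matrices over it are functions on \<open>nat\<close> with values in \<open>[0, \<infinity>]\<close>; only indices \<open>\<ge> 1\<close> are
  ever used. In \<^typ>\<open>ennreal\<close> one has \<open>0 * \<infinity> = 0\<close> and \<open>x ^ 0 = 1\<close>.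
\<close>

type_synonym evec = "nat \<Rightarrow> ennreal"
type_synonym emat = "nat \<Rightarrow> nat \<Rightarrow> ennreal"

definition mat_id :: emat where
  "mat_id i j = (if i = j then 1 else 0)"

definition mat_mult :: "emat \<Rightarrow> emat \<Rightarrow> emat" where
  "mat_mult A B i j = (\<Sum>\<^sub>\<infinity>k\<in>{1..}. A i k * B k j)"

definition mat_scale :: "ennreal \<Rightarrow> emat \<Rightarrow> emat" where
  "mat_scale c A i j = c * A i j"

definition mat_sum :: "('b \<Rightarrow> emat) \<Rightarrow> 'b set \<Rightarrow> emat" where
  "mat_sum A S i j = (\<Sum>s\<in>S. A s i j)"

text \<open>\<open>mat_prod A n\<close> is the ordered product \<open>A 0 \<cdot> A 1 \<cdot> \<dots> \<cdot> A (n - 1)\<close>.\<close>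

primrec mat_prod :: "(nat \<Rightarrow> emat) \<Rightarrow> nat \<Rightarrow> emat" where
  "mat_prod A 0 = mat_id"
| "mat_prod A (Suc n) = mat_mult (mat_prod A n) (A n)"

definition vec_mat :: "evec \<Rightarrow> emat \<Rightarrow> evec" where
  "vec_mat v A j = (\<Sum>\<^sub>\<infinity>i\<in>{1..}. v i * A i j)"

definition vec_dot :: "evec \<Rightarrow> evec \<Rightarrow> ennreal" where
  "vec_dot v w = (\<Sum>\<^sub>\<infinity>j\<in>{1..}. v j * w j)"

definition ones :: evec where
  "ones j = 1"

text \<open>
  \<open>falling n k = n (n - 1) \<cdots> (n - k + 1)\<close>; the truncated subtraction is harmless, since for
  \<open>k > n\<close> the factor with \<open>s = n\<close> vanishes.
\<close>

definition falling :: "nat \<Rightarrow> nat \<Rightarrow> nat" where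
  "falling n k = (\<Prod>s<k. n - s)"

text \<open>
  \<open>d l i j\<close> is the entry \<open>d\<^sub>i\<^sub>j(l)\<close>. \<open>D_deriv d l x\<close> is \<open>D\<^sup>(\<^sup>l\<^sup>)(x)\<close> for \<open>0 \<le> x \<le> 1\<close>; at \<open>x = 1\<close> its
  entries may be infinite.
\<close>

definition D_deriv :: "(nat \<Rightarrow> nat \<Rightarrow> nat \<Rightarrow> real) \<Rightarrow> nat \<Rightarrow> real \<Rightarrow> emat" where
  "D_deriv d l x i j = (\<Sum>\<^sub>\<infinity>r\<in>{l..}. ennreal (real (falling r l) * d r i j * x ^ (r - l)))"

text \<open>\<open>G\<close> is the distribution of the generic service time.\<close>

definition Phi :: "nat pmf \<Rightarrow> nat \<Rightarrow> real" where
  "Phi G t = measure_pmf.prob G {t<..}"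

text \<open>
  \<open>I t\<close> is the background state at time \<open>t\<close>, \<open>B k\<close> the number of customers arriving along with the
  transition from \<open>I k\<close> to \<open>I (k + 1)\<close>, and \<open>Y k n\<close> the service time of the \<open>n\<close>-th of them
  (\<open>n < B k\<close>). The past before time \<open>k\<close> consists of \<open>I 0, \<dots>, I (k - 1)\<close> and
  \<open>B 0, \<dots>, B (k - 1)\<close>.
\<close>

locale dbmap_g_infinity_queue = prob_space M
  for M :: "'a measure" +
  fixes d :: "nat \<Rightarrow> nat \<Rightarrow> nat \<Rightarrow> real"
    and G :: "nat pmf"
    and I :: "nat \<Rightarrow> 'a \<Rightarrow> nat"
    and B :: "nat \<Rightarrow> 'a \<Rightarrow> nat"
    and Y :: "nat \<Rightarrow> nat \<Rightarrow> 'a \<Rightarrow> nat"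
  assumes d_nonneg: "\<And>l i j. i \<ge> 1 \<Longrightarrow> j \<ge> 1 \<Longrightarrow> d l i j \<ge> 0"
    and d_stochastic: "\<And>i. i \<ge> 1 \<Longrightarrow> ((\<lambda>(j, l). d l i j) has_sum 1) ({1..} \<times> UNIV)"
    and I_measurable: "\<And>k. random_variable (count_space UNIV) (I k)"
    and I_states: "\<And>k \<omega>. \<omega> \<in> space M \<Longrightarrow> I k \<omega> \<ge> 1"
    and B_measurable: "\<And>k. random_variable (count_space UNIV) (B k)"
    and transition:
      "\<And>k l j h b. j \<ge> 1 \<Longrightarrow>
         \<P>(\<omega> in M. (\<forall>s\<le>k. I s \<omega> = h s) \<and> (\<forall>s<k. B s \<omega> = b s)) > 0 \<Longrightarrow>
         \<P>(\<omega> in M. I (Suc k) \<omega> = j \<and> B k \<omega> = l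
             \<bar> (\<forall>s\<le>k. I s \<omega> = h s) \<and> (\<forall>s<k. B s \<omega> = b s)) = d l (h k) j"
    and service_positive: "set_pmf G \<subseteq> {1..}"
    and service_measurable: "\<And>k n. random_variable (count_space UNIV) (Y k n)"
    and service_distr: "\<And>k n. distr M (count_space UNIV) (Y k n) = measure_pmf G"
    and service_indep: "indep_vars (\<lambda>_. count_space UNIV) (\<lambda>(k, n). Y k n) UNIV"
    and service_indep_arrivals:
      "indep_set
         (sets (vimage_algebra (space M) (\<lambda>\<omega> k. (I k \<omega>, B k \<omega>))
                  (Pi\<^sub>M UNIV (\<lambda>_. count_space UNIV))))
         (sets (vimage_algebra (space M) (\<lambda>\<omega> (k, n). Y k n \<omega>)
                  (Pi\<^sub>M UNIV (\<lambda>_. count_space UNIV))))"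

definition init_dist :: "'a measure \<Rightarrow> (nat \<Rightarrow> 'a \<Rightarrow> nat) \<Rightarrow> evec" where
  "init_dist M I i = emeasure M {\<omega> \<in> space M. I 0 \<omega> = i}"

definition num_customers ::
  "(nat \<Rightarrow> 'a \<Rightarrow> nat) \<Rightarrow> (nat \<Rightarrow> nat \<Rightarrow> 'a \<Rightarrow> nat) \<Rightarrow> nat \<Rightarrow> 'a \<Rightarrow> nat" where
  "num_customers B Y t \<omega> = (\<Sum>k<t. card {n. n < B k \<omega> \<and> k + Y k n \<omega> > t})"

definition num_dist ::
  "'a measure \<Rightarrow> (nat \<Rightarrow> 'a \<Rightarrow> nat) \<Rightarrow> (nat \<Rightarrow> nat \<Rightarrow> 'a \<Rightarrow> nat) \<Rightarrow> nat \<Rightarrow> nat \<Rightarrow> ennreal" where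
  "num_dist M B Y m t = emeasure M {\<omega> \<in> space M. num_customers B Y t \<omega> = m}"

definition factorial_moment ::
  "'a measure \<Rightarrow> (nat \<Rightarrow> 'a \<Rightarrow> nat) \<Rightarrow> (nat \<Rightarrow> nat \<Rightarrow> 'a \<Rightarrow> nat) \<Rightarrow> nat \<Rightarrow> nat \<Rightarrow> ennreal" where
  "factorial_moment M B Y k t = (\<Sum>\<^sub>\<infinity>m. of_nat (falling m k) * num_dist M B Y m t)"

text \<open>The tuples \<open>(l\<^sub>0, \<dots>, l\<^sub>t\<^sub>-\<^sub>1)\<close> of naturals with sum \<open>m\<close>, as functions on \<open>{..<t}\<close>.\<close>

definition compositions :: "nat \<Rightarrow> nat \<Rightarrow> (nat \<Rightarrow> nat) set" where
  "compositions t m = {l \<in> {..<t} \<rightarrow>\<^sub>E UNIV. (\<Sum>i<t. l i) = m}"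

definition multinomial_coeff :: "nat \<Rightarrow> nat \<Rightarrow> (nat \<Rightarrow> nat) \<Rightarrow> ennreal" where
  "multinomial_coeff t m l = ennreal (fact m / (\<Prod>i<t. fact (l i)))"

end

theory Submission
  imports Defs
begin

text \<open>
  Write \<open>N\<^sub>k\<close> for the number of customers of the \<open>k\<close>-th batch that are still in service at time
  \<open>t\<close>. Given the arrivals, the \<open>N\<^sub>k\<close> are independent and binomial with parameters \<open>B\<^sub>k\<close> and
  \<open>\<Phi>(t - k)\<close>. Averaging a product \<open>\<Prod>\<^sub>k w\<^sub>k(N\<^sub>k)\<close> first over the service times and then step by step
  along the background chain gives the matrix product \<open>p\<^sub>0 E\<^sub>0 \<cdots> E\<^sub>t\<^sub>-\<^sub>1 1\<close>, where \<open>E\<^sub>k\<close> is the sum over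
  \<open>b\<close> of \<open>D\<^sub>b\<close> times the binomial mean of \<open>w\<^sub>k\<close>. The choices \<open>w(n) = l! 1{n = l}\<close> and
  \<open>w(n) = n (n - 1) \<cdots> (n - l + 1)\<close> turn \<open>E\<^sub>k\<close> into \<open>\<Phi>\<^sup>l D\<^sup>(\<^sup>l\<^sup>)(1 - \<Phi>)\<close> and \<open>\<Phi>\<^sup>l D\<^sup>(\<^sup>l\<^sup>)(1)\<close>; summing over
  compositions recovers the indicator of \<open>\<Sum>N\<^sub>k = m\<close> trivially and the falling factorial of \<open>\<Sum>N\<^sub>k\<close>
  by Vandermonde's identity.
\<close>

section \<open>Falling factorials and sums over compositions\<close>

lemma falling_conv_choose: "falling n k = fact k * (n choose k)"
proof (cases "k \<le> n")
  case True
  have "falling n k * fact (n - k) = fact n"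
    using True
  proof (induction k)
    case (Suc k)
    then have "fact (n - k) = (n - k) * fact (n - Suc k)"
      by (simp add: fact_reduce Suc_diff_Suc)
    then show ?case using Suc by (simp add: falling_def algebra_simps)
  qed (simp add: falling_def)
  moreover have "fact k * (n choose k) * fact (n - k) = fact n"
    using binomial_fact_lemma[OF True] by (simp add: algebra_simps)
  ultimately show ?thesis
    by (metis fact_nonzero mult_right_cancel)
next
  case False
  then have "(\<Prod>s<k. n - s) = 0" by (intro prod_zero) auto
  with False show ?thesis by (simp add: falling_def del: prod_zero_iff)
qed

lemma finite_compositions [simp]: "finite (compositions t m)"
proof (rule finite_subset)
  show "compositions t m \<subseteq> {..<t} \<rightarrow>\<^sub>E {..m}"
  proof
    fix l assume l: "l \<in> compositions t m"
    then have "l i \<le> m" if "i < t" for i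
      using that member_le_sum[of i "{..<t}" l] by (simp add: compositions_def)
    with l show "l \<in> {..<t} \<rightarrow>\<^sub>E {..m}" by (simp add: compositions_def PiE_iff)
  qed
qed (simp add: finite_PiE)

lemma sum_compositions_Suc:
  fixes f :: "(nat \<Rightarrow> nat) \<Rightarrow> 'c :: comm_monoid_add"
  shows "(\<Sum>l\<in>compositions (Suc t) m. f l) =
           (\<Sum>j\<le>m. \<Sum>l\<in>compositions t (m - j). f (l(t := j)))"
proof -
  have "(\<Sum>l\<in>compositions (Suc t) m. f l) =
      (\<Sum>(j, l)\<in>Sigma {..m} (\<lambda>j. compositions t (m - j)). f (l(t := j)))"
    \<comment> \<open>The last part \<open>j = l t\<close> is split off. Resetting position
      \<open>t\<close> to \<open>undefined\<close> makes the rest extensional on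
      \<open>{..<t}\<close>, as \<open>compositions t (m - j)\<close> demands.\<close>
    by (rule sum.reindex_bij_witness[where i = "\<lambda>(j, l). l(t := j)"
          and j = "\<lambda>l. (l t, l(t := undefined))"])
       (auto simp: compositions_def PiE_iff extensional_def lessThan_Suc fun_eq_iff
         intro!: sum.cong)
  then show ?thesis by (simp add: sum.Sigma)
qed

text \<open>Vandermonde's identity for two summands, iterated by peeling off the last summand
  \<open>n t\<close>.\<close>

lemma choose_sum_compositions:
  "(\<Sum>i<t. n i) choose m = (\<Sum>l\<in>compositions t m. \<Prod>i<t. n i choose l i)"
proof (induction t arbitrary: m)
  case 0
  show ?case by (cases m) (auto simp: compositions_def)
next
  case (Suc t)
  have "(\<Sum>l\<in>compositions (Suc t) m. \<Prod>i<Suc t. n i choose l i) =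
      (\<Sum>j\<le>m. (n t choose j) * (\<Sum>l\<in>compositions t (m - j). \<Prod>i<t. n i choose l i))"
    by (simp add: sum_compositions_Suc sum_distrib_left mult.commute)
  also have "\<dots> = (\<Sum>i<Suc t. n i) choose m"
    by (simp add: Suc[symmetric] vandermonde add.commute)
  finally show ?case ..
qed

text \<open>The factorials \<open>fact (l i)\<close> hidden in the falling factorials cancel the
  denominator of the multinomial coefficient. Each term becomes \<open>fact m\<close> times a
  product of binomial coefficients, and the iterated Vandermonde identity applies.\<close>

lemma falling_sum_compositions:
  "(of_nat (falling (\<Sum>i<t. n i) m) :: ennreal) =
     (\<Sum>l\<in>compositions t m. multinomial_coeff t m l * (\<Prod>i<t. of_nat (falling (n i) (l i))))"
proof -
  have "multinomial_coeff t m l * (\<Prod>i<t. of_nat (falling (n i) (l i))) =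
      of_nat (fact m * (\<Prod>i<t. n i choose l i))" for l
  proof -
    have "(\<Prod>i<t. of_nat (falling (n i) (l i))) =
        ennreal ((\<Prod>i<t. fact (l i)) * real (\<Prod>i<t. n i choose l i))"
      by (simp add: ennreal_of_nat_eq_real_of_nat prod_ennreal falling_conv_choose prod.distrib)
    then show ?thesis
      unfolding multinomial_coeff_def
      by (simp add: ennreal_of_nat_eq_real_of_nat prod_nonneg flip: ennreal_mult)
  qed
  then show ?thesis
    by (simp add: falling_conv_choose choose_sum_compositions sum_distrib_left
        flip: of_nat_sum of_nat_mult)
qed

text \<open>At most one composition contributes, namely \<open>n\<close> itself cut down to
  \<open>{..<t}\<close>. The weights \<open>fact (l i)\<close> are there to cancel the multinomial
  denominator.\<close>

lemma indicator_sum_compositions: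
  "(if (\<Sum>i<t. n i) = m then 1 else 0 :: ennreal) =
     ennreal (1 / fact m) * (\<Sum>l\<in>compositions t m. multinomial_coeff t m l *
       (\<Prod>i<t. if n i = l i then fact (l i) else 0))"
proof -
  let ?n = "restrict n {..<t}"
  have *: "(\<Prod>i<t. if n i = l i then fact (l i) else 0 :: ennreal) =
      (if l = ?n then (\<Prod>i<t. fact (n i)) else 0)" if "l \<in> compositions t m" for l
  proof (cases "l = ?n")
    case False
    have "\<exists>i<t. n i \<noteq> l i"
    proof (rule ccontr)
      assume "\<not> (\<exists>i<t. n i \<noteq> l i)"
      then have "l i = ?n i" for i
        using that by (cases "i < t") (auto simp: compositions_def PiE_iff extensional_def)
      with False show False by blast
    qed
    then have "(\<Prod>i<t. if n i = l i then fact (l i) else 0 :: ennreal) = 0"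
      by (intro prod_zero) auto
    with False show ?thesis by (simp del: prod_zero_iff)
  next
    case True
    then have "(\<Prod>i<t. if n i = l i then fact (l i) else 0 :: ennreal) = (\<Prod>i<t. fact (n i))"
      by (intro prod.cong) auto
    with True show ?thesis by simp
  qed
  have fact_ennreal: "(fact j :: ennreal) = ennreal (fact j)" for j
    by (metis ennreal_of_nat_eq_real_of_nat of_nat_fact)
  have "(\<Sum>l\<in>compositions t m. multinomial_coeff t m l *
       (\<Prod>i<t. if n i = l i then fact (l i) else 0)) =
      (\<Sum>l\<in>compositions t m. if l = ?n then multinomial_coeff t m ?n * (\<Prod>i<t. fact (n i)) else 0)"
    by (intro sum.cong refl) (auto simp: *)
  also have "\<dots> = (if (\<Sum>i<t. n i) = m then multinomial_coeff t m ?n * (\<Prod>i<t. fact (n i)) else 0)"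
  proof -
    have "?n \<in> compositions t m \<longleftrightarrow> (\<Sum>i<t. n i) = m"
      by (simp add: compositions_def)
    then show ?thesis by simp
  qed
  \<comment> \<open>This holds whether or not the \<open>n i\<close> add up to \<open>m\<close>,
    because \<open>multinomial_coeff\<close> is a plain quotient with numerator
    \<open>fact m\<close>.\<close>
  also have "multinomial_coeff t m ?n * (\<Prod>i<t. fact (n i)) = fact m"
    unfolding multinomial_coeff_def
    by (simp add: fact_ennreal prod_ennreal prod_nonneg flip: ennreal_mult)
  finally show ?thesis
    by (simp add: fact_ennreal flip: ennreal_mult)
qed

section \<open>Countable sums as integrals, and matrix algebra over [0, \<infinity>]\<close>

lemma infsum_conv_nn_integral:
  fixes f :: "nat \<Rightarrow> ennreal"
  shows "infsum f A = (\<integral>\<^sup>+x. f x \<partial>count_space A)"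
proof -
  have "infsum f A = (\<Sum>\<^sub>\<infinity>x. f x * indicator A x)"
    by (rule infsum_cong_neutral) auto
  also have "\<dots> = (\<Sum>x. f x * indicator A x)"
    by (intro sums_unique has_sum_imp_sums has_sum_infsum nonneg_summable_on_complete) simp
  also have "\<dots> = (\<integral>\<^sup>+x. f x * indicator A x \<partial>count_space UNIV)"
    by (rule nn_integral_count_space_nat[symmetric])
  also have "\<dots> = (\<integral>\<^sup>+x. f x \<partial>count_space A)"
    by (cases "A = UNIV") (simp_all add: nn_integral_restrict_space[symmetric] restrict_count_space)
  finally show ?thesis .
qed

text \<open>Associativity is Tonelli's theorem for counting measures, so no summability has to be
  checked. It lets the matrix product be applied to the row vector one factor at a time.\<close>

lemma vec_mat_mat_mult: "vec_mat v (mat_mult P Q) = vec_mat (vec_mat v P) Q"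
proof
  fix j
  have "vec_mat v (mat_mult P Q) j =
      (\<integral>\<^sup>+i. \<integral>\<^sup>+k. v i * P i k * Q k j \<partial>count_space {1..} \<partial>count_space {1..})"
    by (simp add: vec_mat_def mat_mult_def infsum_conv_nn_integral mult.assoc
        flip: nn_integral_cmult)
  also have "\<dots> = (\<integral>\<^sup>+k. \<integral>\<^sup>+i. v i * P i k * Q k j \<partial>count_space {1..} \<partial>count_space {1..})"
    by (rule nn_integral_count_space_nn_integral) auto
  also have "\<dots> = vec_mat (vec_mat v P) Q j"
    by (simp add: vec_mat_def infsum_conv_nn_integral nn_integral_multc)
  finally show "vec_mat v (mat_mult P Q) j = vec_mat (vec_mat v P) Q j" .
qed

text \<open>The sum runs over indices from 1 on, so at \<open>j = 0\<close> the left side would be 0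
  whatever \<open>v 0\<close> is.\<close>

lemma vec_mat_mat_id:
  assumes "j \<ge> 1"
  shows "vec_mat v mat_id j = v j"
proof -
  have "vec_mat v mat_id j = infsum (\<lambda>i. v i * mat_id i j) {j}"
    unfolding vec_mat_def using assms by (intro infsum_cong_neutral) (auto simp: mat_id_def)
  then show ?thesis by (simp add: mat_id_def)
qed

lemma vec_dot_mat_sum:
  "vec_dot (vec_mat v (mat_sum (\<lambda>s. mat_scale (c s) (A s)) S)) w =
     (\<Sum>s\<in>S. c s * vec_dot (vec_mat v (A s)) w)"
proof -
  have "vec_mat v (mat_sum (\<lambda>s. mat_scale (c s) (A s)) S) j =
      (\<Sum>s\<in>S. c s * vec_mat v (A s) j)" for j
  proof -
    have "v i * mat_sum (\<lambda>s. mat_scale (c s) (A s)) S i j = (\<Sum>s\<in>S. c s * (v i * A s i j))" for i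
      by (simp add: mat_sum_def mat_scale_def sum_distrib_left mult.left_commute)
    then show ?thesis
      by (simp add: vec_mat_def infsum_conv_nn_integral nn_integral_sum nn_integral_cmult)
  qed
  then show ?thesis
    by (simp add: vec_dot_def infsum_conv_nn_integral sum_distrib_right mult.assoc
        nn_integral_sum nn_integral_cmult)
qed

section \<open>Averages over a binomial distribution\<close>

definition binomial_mean :: "real \<Rightarrow> nat \<Rightarrow> (nat \<Rightarrow> ennreal) \<Rightarrow> ennreal" where
  "binomial_mean p b w = (\<Sum>n\<le>b. ennreal (real (b choose n) * p ^ n * (1 - p) ^ (b - n)) * w n)"

text \<open>Only \<open>n = l\<close> survives, and \<open>fact l\<close> turns the binomial
  coefficient into a falling factorial. The result is what \<open>p ^ l\<close> times the
  \<open>l\<close>-th derivative of \<open>x ^ b\<close> at \<open>1 - p\<close> gives.\<close>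

lemma binomial_mean_indicator:
  assumes "0 \<le> p" "p \<le> 1"
  shows "binomial_mean p b (\<lambda>n. if n = l then fact l else 0) =
           ennreal (real (falling b l) * p ^ l * (1 - p) ^ (b - l))"
proof -
  have fact_ennreal: "(fact l :: ennreal) = ennreal (fact l)"
    by (metis ennreal_of_nat_eq_real_of_nat of_nat_fact)
  have "binomial_mean p b (\<lambda>n. if n = l then fact l else 0) =
      (\<Sum>n\<le>b. if n = l then ennreal (real (b choose l) * p ^ l * (1 - p) ^ (b - l)) * fact l else 0)"
    unfolding binomial_mean_def by (intro sum.cong) auto
  also have "\<dots> = ennreal (real (falling b l) * p ^ l * (1 - p) ^ (b - l))"
    using assms by (auto simp: falling_conv_choose fact_ennreal algebra_simps simp flip: ennreal_mult)
  finally show ?thesis .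
qed

text \<open>Choosing \<open>n\<close> of \<open>b\<close> and then \<open>l\<close> of those
  \<open>n\<close> is choosing \<open>l\<close> of \<open>b\<close> and then \<open>n - l\<close> of
  the other \<open>b - l\<close>. The factor depending on \<open>l\<close> alone comes out, and the
  binomial theorem for p + (1 - p) = 1 sums the rest to 1.\<close>

lemma binomial_mean_falling:
  assumes "0 \<le> p" "p \<le> 1"
  shows "binomial_mean p b (\<lambda>n. of_nat (falling n l)) = ennreal (real (falling b l) * p ^ l)"
proof -
  have "binomial_mean p b (\<lambda>n. of_nat (falling n l)) =
      ennreal (\<Sum>n\<le>b. real (b choose n) * p ^ n * (1 - p) ^ (b - n) * real (falling n l))"
    using assms unfolding binomial_mean_def
    by (simp add: ennreal_of_nat_eq_real_of_nat flip: ennreal_mult)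
  also have "(\<Sum>n\<le>b. real (b choose n) * p ^ n * (1 - p) ^ (b - n) * real (falling n l)) =
      real (falling b l) * p ^ l"
  proof (cases "l \<le> b")
    case True
    have "(\<Sum>n\<le>b. real (b choose n) * p ^ n * (1 - p) ^ (b - n) * real (falling n l)) =
        (\<Sum>n\<in>{l..b}. real (b choose n) * p ^ n * (1 - p) ^ (b - n) * real (falling n l))"
      by (rule sum.mono_neutral_right) (auto simp: falling_conv_choose)
    also have "\<dots> = (\<Sum>n\<in>{l..b}. real (falling b l) * p ^ l *
        (real ((b - l) choose (n - l)) * p ^ (n - l) * (1 - p) ^ (b - l - (n - l))))"
    proof (intro sum.cong refl)
      fix n assume n: "n \<in> {l..b}"
      then have "(b choose n) * (n choose l) = (b choose l) * ((b - l) choose (n - l))"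
        by (intro choose_mult) auto
      then have c: "real (b choose n) * real (n choose l) =
          real (b choose l) * real ((b - l) choose (n - l))"
        by (metis of_nat_mult)
      have "p ^ n = p ^ l * p ^ (n - l)" using n by (simp flip: power_add)
      with c n show "real (b choose n) * p ^ n * (1 - p) ^ (b - n) * real (falling n l) =
          real (falling b l) * p ^ l *
            (real ((b - l) choose (n - l)) * p ^ (n - l) * (1 - p) ^ (b - l - (n - l)))"
        by (simp add: falling_conv_choose mult_ac)
    qed
    also have "\<dots> = (\<Sum>n\<le>b - l. real (falling b l) * p ^ l *
        (real ((b - l) choose n) * p ^ n * (1 - p) ^ (b - l - n)))"
      by (rule sum.reindex_bij_witness[where i = "\<lambda>n. n + l" and j = "\<lambda>n. n - l"])
         (use True in auto)
    also have "\<dots> = real (falling b l) * p ^ l"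
      using binomial_ring[of p "1 - p" "b - l"] by (simp flip: sum_distrib_left)
    finally show ?thesis .
  next
    case False
    then show ?thesis
      by (auto simp: falling_conv_choose binomial_eq_0 intro!: sum.neutral)
  qed
  finally show ?thesis .
qed

text \<open>The integral is split by the exact set \<open>T\<close> of successful trials. By
  independence a set \<open>S\<close> has probability depending on its size only, and counting the
  sets of each size produces the binomial coefficients.\<close>

lemma (in prob_space) nn_integral_binomial_mean:
  fixes X :: "nat \<Rightarrow> 'a \<Rightarrow> 'c"
  assumes indep: "indep_vars (\<lambda>_. N) X {..<b}"
    and A: "A \<in> sets N"
    and p: "\<And>n. n < b \<Longrightarrow> prob (X n -` A \<inter> space M) = p"
  shows "(\<integral>\<^sup>+\<omega>. w (card {n. n < b \<and> X n \<omega> \<in> A}) \<partial>M) = binomial_mean p b w"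
proof -
  define T where "T \<omega> = {n. n < b \<and> X n \<omega> \<in> A}" for \<omega>
  have X: "random_variable N (X n)" if "n < b" for n
    using indep that by (auto simp: indep_vars_def)
  have compl: "prob (X n -` (space N - A) \<inter> space M) = 1 - p" if "n < b" for n
  proof -
    have "X n -` (space N - A) \<inter> space M = space M - (X n -` A \<inter> space M)"
      using measurable_space[OF X[OF that]] by auto
    then show ?thesis using prob_compl[OF measurable_sets[OF X[OF that] A]] p[OF that] by simp
  qed
  \<comment> \<open>The outer intersection with \<open>space M\<close> matters for
    \<open>b = 0\<close>, where the intersection over the empty index set is the whole type.\<close>
  have T_eq: "{\<omega>\<in>space M. T \<omega> = S} =
      (\<Inter>n\<in>{..<b}. X n -` (if n \<in> S then A else space N - A) \<inter> space M) \<inter> space M"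
    if "S \<subseteq> {..<b}" for S
  proof -
    have "T \<omega> = S \<longleftrightarrow> (\<forall>n<b. X n \<omega> \<in> (if n \<in> S then A else space N - A))"
      if \<omega>: "\<omega> \<in> space M" for \<omega>
    proof -
      have "T \<omega> = S \<longleftrightarrow> (\<forall>n<b. X n \<omega> \<in> A \<longleftrightarrow> n \<in> S)"
        using \<open>S \<subseteq> {..<b}\<close> by (auto simp: T_def)
      then show ?thesis using X[THEN measurable_space, OF _ \<omega>] by auto
    qed
    then show ?thesis by auto
  qed
  have T_meas: "{\<omega>\<in>space M. T \<omega> = S} \<in> events" if "S \<subseteq> {..<b}" for S
  proof (cases "b = 0")
    case False
    have "(\<Inter>n\<in>{..<b}. X n -` (if n \<in> S then A else space N - A) \<inter> space M) \<in> events"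
      using False A by (intro sets.finite_INT measurable_sets[OF X]) auto
    then show ?thesis unfolding T_eq[OF that] by (rule sets.Int) simp
  qed (simp add: T_def)
  have T_prob: "prob {\<omega>\<in>space M. T \<omega> = S} = p ^ card S * (1 - p) ^ (b - card S)"
    if S: "S \<subseteq> {..<b}" for S
  \<comment> \<open>The product rule for independent events asks for a nonempty index set.\<close>
  proof (cases "b = 0")
    case True
    then show ?thesis using S by (simp add: T_def prob_space)
  next
    case False
    have "{\<omega>\<in>space M. T \<omega> = S} =
        (\<Inter>n\<in>{..<b}. X n -` (if n \<in> S then A else space N - A) \<inter> space M)"
      unfolding T_eq[OF S] using False by auto
    then have "prob {\<omega>\<in>space M. T \<omega> = S} =
        prob (\<Inter>n\<in>{..<b}. X n -` (if n \<in> S then A else space N - A) \<inter> space M)"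
      by (rule arg_cong)
    also have "\<dots> = (\<Prod>n<b. prob (X n -` (if n \<in> S then A else space N - A) \<inter> space M))"
      by (rule indep_varsD_finite[OF indep]) (use False A in auto)
    also have "\<dots> = (\<Prod>n<b. if n \<in> S then p else 1 - p)"
      by (intro prod.cong) (auto simp: p compl)
    also have "\<dots> = p ^ card S * (1 - p) ^ card ({..<b} - S)"
      using S by (simp add: prod.If_cases Int_absorb1 Diff_eq[symmetric])
    also have "card ({..<b} - S) = b - card S"
      using S by (simp add: card_Diff_subset finite_subset)
    finally show ?thesis .
  qed
  have "(\<integral>\<^sup>+\<omega>. w (card (T \<omega>)) \<partial>M) =
      (\<integral>\<^sup>+\<omega>. (\<Sum>S\<in>Pow {..<b}. w (card S) * indicator {\<omega>\<in>space M. T \<omega> = S} \<omega>) \<partial>M)"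
  proof (intro nn_integral_cong)
    fix \<omega> assume "\<omega> \<in> space M"
    then have "(\<Sum>S\<in>Pow {..<b}. w (card S) * indicator {\<omega>\<in>space M. T \<omega> = S} \<omega>) =
        (\<Sum>S\<in>Pow {..<b}. if S = T \<omega> then w (card (T \<omega>)) else 0)"
      by (intro sum.cong) auto
    also have "\<dots> = w (card (T \<omega>))" by (auto simp: T_def)
    finally show "w (card (T \<omega>)) =
        (\<Sum>S\<in>Pow {..<b}. w (card S) * indicator {\<omega>\<in>space M. T \<omega> = S} \<omega>)" ..
  qed
  also have "\<dots> = (\<Sum>S\<in>Pow {..<b}. w (card S) * emeasure M {\<omega>\<in>space M. T \<omega> = S})"
    using T_meas by (subst nn_integral_sum) (auto simp: nn_integral_cmult_indicator)
  also have "\<dots> = (\<Sum>S\<in>Pow {..<b}. w (card S) * ennreal (p ^ card S * (1 - p) ^ (b - card S)))"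
    by (intro sum.cong refl) (auto simp: emeasure_eq_measure T_prob)
  also have "\<dots> = (\<Sum>n\<le>b. \<Sum>S\<in>{S\<in>Pow {..<b}. card S = n}.
      w (card S) * ennreal (p ^ card S * (1 - p) ^ (b - card S)))"
    by (rule sum.group[symmetric]) (auto dest: card_mono[rotated])
  also have "\<dots> = (\<Sum>n\<le>b. of_nat (b choose n) * (w n * ennreal (p ^ n * (1 - p) ^ (b - n))))"
    by (intro sum.cong refl) (simp add: n_subsets)
  also have "\<dots> = binomial_mean p b w"
  proof -
    have "ennreal (real (b choose n) * p ^ n * (1 - p) ^ (b - n)) =
        of_nat (b choose n) * ennreal (p ^ n * (1 - p) ^ (b - n))" for n
      by (simp add: mult.assoc ennreal_mult' ennreal_of_nat_eq_real_of_nat)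
    then show ?thesis by (simp add: binomial_mean_def mult_ac)
  qed
  finally show ?thesis by (simp add: T_def)
qed

section \<open>Conditioning on countably many values\<close>

lemma nn_integral_partition_countable:
  fixes H :: "'a \<Rightarrow> 'c :: countable"
  assumes [measurable]: "H \<in> measurable M (count_space UNIV)" "f \<in> borel_measurable M"
  shows "(\<integral>\<^sup>+\<omega>. f \<omega> \<partial>M) =
           (\<integral>\<^sup>+h. \<integral>\<^sup>+\<omega>. f \<omega> * indicator {h} (H \<omega>) \<partial>M \<partial>count_space UNIV)"
proof -
  have "(\<integral>\<^sup>+h. f \<omega> * indicator {h} (H \<omega>) \<partial>count_space UNIV) = f \<omega>" for \<omega>
    by (subst nn_integral_count_space'[where A = "{H \<omega>}"]) auto
  then have "(\<integral>\<^sup>+\<omega>. f \<omega> \<partial>M) =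
      (\<integral>\<^sup>+\<omega>. \<integral>\<^sup>+h. f \<omega> * indicator {h} (H \<omega>) \<partial>count_space UNIV \<partial>M)"
    by simp
  also have "\<dots> = (\<integral>\<^sup>+h. \<integral>\<^sup>+\<omega>. f \<omega> * indicator {h} (H \<omega>) \<partial>M \<partial>count_space UNIV)"
    by (rule nn_integral_count_space_nn_integral) auto
  finally show ?thesis .
qed

text \<open>Finite families are coded as lists because lists over a countable type are again
  countable: every function of such a list is measurable, and an integral can be split over its
  values.\<close>

lemma measurable_map_upt:
  fixes X :: "nat \<Rightarrow> 'a \<Rightarrow> 'c :: countable"
  assumes "\<And>k. k < n \<Longrightarrow> X k \<in> measurable M (count_space UNIV)"
  shows "(\<lambda>\<omega>. map (\<lambda>k. X k \<omega>) [0..<n]) \<in> measurable M (count_space UNIV)"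
  using assms
proof (induction n)
  case (Suc n)
  have "(\<lambda>\<omega>. xs @ [X n \<omega>]) \<in> measurable M (count_space UNIV)" for xs
    by (rule measurable_compose[OF Suc.prems]) auto
  then have "(\<lambda>\<omega>. map (\<lambda>k. X k \<omega>) [0..<n] @ [X n \<omega>]) \<in> measurable M (count_space UNIV)"
    by (rule measurable_compose_countable) (use Suc in auto)
  then show ?case by simp
qed simp

lemma measurable_card_lessThan:
  fixes X :: "nat \<Rightarrow> 'a \<Rightarrow> nat"
  assumes "\<And>n. n < b \<Longrightarrow> X n \<in> measurable M (count_space UNIV)"
  shows "(\<lambda>\<omega>. card {n. n < b \<and> P (X n \<omega>)}) \<in> measurable M (count_space UNIV)"
proof -
  have "(\<lambda>\<omega>. card {n. n < b \<and> P (map (\<lambda>n. X n \<omega>) [0..<b] ! n)}) \<in>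
      measurable M (count_space UNIV)"
    by (rule measurable_compose[OF measurable_map_upt]) (use assms in auto)
  moreover have "{n. n < b \<and> P (map (\<lambda>n. X n \<omega>) [0..<b] ! n)} = {n. n < b \<and> P (X n \<omega>)}" for \<omega>
    by (rule Collect_cong) (simp cong: conj_cong)
  ultimately show ?thesis by (simp only:)
qed

text \<open>For a countable-valued \<open>K\<close>, independence of \<open>A\<close> from the
  single values of \<open>K\<close> suffices to factor the integral of any function of
  \<open>K\<close>: split over the values, factor, and reassemble.\<close>

lemma (in prob_space) nn_integral_indep_countable:
  fixes K :: "'a \<Rightarrow> 'c :: countable"
  assumes [measurable]: "A \<in> events" "random_variable (count_space UNIV) K"
    and indep: "\<And>\<kappa>. prob (A \<inter> {\<omega>\<in>space M. K \<omega> = \<kappa>}) = prob A * prob {\<omega>\<in>space M. K \<omega> = \<kappa>}"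
  shows "(\<integral>\<^sup>+\<omega>. g (K \<omega>) * indicator A \<omega> \<partial>M) = (\<integral>\<^sup>+\<omega>. g (K \<omega>) \<partial>M) * emeasure M A"
proof -
  have *: "(\<integral>\<^sup>+\<omega>. g (K \<omega>) * indicator A' \<omega> * indicator {\<kappa>} (K \<omega>) \<partial>M) =
      g \<kappa> * emeasure M (A' \<inter> {\<omega>\<in>space M. K \<omega> = \<kappa>})" if [measurable]: "A' \<in> events" for A' \<kappa>
  proof -
    have "(\<integral>\<^sup>+\<omega>. g (K \<omega>) * indicator A' \<omega> * indicator {\<kappa>} (K \<omega>) \<partial>M) =
        (\<integral>\<^sup>+\<omega>. g \<kappa> * indicator (A' \<inter> {\<omega>\<in>space M. K \<omega> = \<kappa>}) \<omega> \<partial>M)"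
      by (intro nn_integral_cong) (auto split: split_indicator)
    then show ?thesis by (simp add: nn_integral_cmult_indicator)
  qed
  have "(\<integral>\<^sup>+\<omega>. g (K \<omega>) * indicator A \<omega> \<partial>M) =
      (\<integral>\<^sup>+\<kappa>. g \<kappa> * emeasure M (A \<inter> {\<omega>\<in>space M. K \<omega> = \<kappa>}) \<partial>count_space UNIV)"
    by (subst nn_integral_partition_countable[where H = K]) (auto simp: *)
  \<comment> \<open>Intersecting with \<open>space M\<close> brings the event into the form of
    \<open>*\<close> with \<open>A' = space M\<close>, so that the same computation can be run
    backwards.\<close>
  also have "\<dots> = (\<integral>\<^sup>+\<kappa>. g \<kappa> * emeasure M (space M \<inter> {\<omega>\<in>space M. K \<omega> = \<kappa>}) * emeasure M A
      \<partial>count_space UNIV)"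
    by (intro nn_integral_cong) (auto simp: emeasure_eq_measure indep ennreal_mult mult_ac)
  also have "\<dots> = (\<integral>\<^sup>+\<omega>. g (K \<omega>) * indicator (space M) \<omega> \<partial>M) * emeasure M A"
    by (subst nn_integral_partition_countable[where H = K]) (auto simp: * nn_integral_multc)
  also have "(\<integral>\<^sup>+\<omega>. g (K \<omega>) * indicator (space M) \<omega> \<partial>M) = (\<integral>\<^sup>+\<omega>. g (K \<omega>) \<partial>M)"
    by (intro nn_integral_cong) auto
  finally show ?thesis .
qed

section \<open>Averaging over the service times\<close>

context dbmap_g_infinity_queue
begin

lemmas [measurable] = I_measurable B_measurable service_measurable

definition in_service :: "nat \<Rightarrow> nat \<Rightarrow> 'a \<Rightarrow> nat" where
  "in_service t k \<omega> = card {n. n < B k \<omega> \<and> t < k + Y k n \<omega>}"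

lemma num_customers_eq: "num_customers B Y t \<omega> = (\<Sum>k<t. in_service t k \<omega>)"
  by (simp add: num_customers_def in_service_def)

text \<open>The number of customers inspected is itself random, so measurability is shown for each
  fixed batch size and then composed with the countable-valued \<open>B k\<close>.\<close>

lemma in_service_measurable [measurable]:
  "in_service t k \<in> measurable M (count_space UNIV)"
  unfolding in_service_def
  by (rule measurable_compose_countable[where g = "B k"])
     (auto intro!: measurable_card_lessThan[where P = "\<lambda>y. t < k + y"])

lemma num_customers_measurable [measurable]:
  "num_customers B Y t \<in> measurable M (count_space UNIV)"
  unfolding num_customers_eq[abs_def] by measurable

lemma prob_service:
  assumes "k \<le> t"
  shows "prob (Y k n -` {y. t < k + y} \<inter> space M) = Phi G (t - k)"
proof -
  have "{y. t < k + y} = {t - k<..}" using assms by auto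
  moreover have "prob (Y k n -` {t - k<..} \<inter> space M) =
      measure (distr M (count_space UNIV) (Y k n)) {t - k<..}"
    by (rule measure_distr[symmetric]) auto
  ultimately show ?thesis by (simp add: service_distr Phi_def)
qed

text \<open>Here the batch sizes \<open>b\<close> are deterministic. Different batches read disjoint
  blocks of the array of service times, so the expectation factors; within one block the survivors
  are counted by independent trials of probability \<Phi>(t - k).\<close>

lemma nn_integral_service_batches:
  "(\<integral>\<^sup>+\<omega>. (\<Prod>k<t. w k (card {n. n < b k \<and> t < k + Y k n \<omega>})) \<partial>M) =
     (\<Prod>k<t. binomial_mean (Phi G (t - k)) (b k) (w k))"
proof -
  let ?K = "\<lambda>k. {k} \<times> {..<b k}"
  have "indep_vars (\<lambda>k. PiM (?K k) (\<lambda>_. count_space UNIV))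
      (\<lambda>k \<omega>. restrict (\<lambda>i. (case i of (k, n) \<Rightarrow> Y k n) \<omega>) (?K k)) {..<t}"
    by (rule indep_vars_restrict[OF service_indep]) (auto simp: disjoint_family_on_def)
  then have "indep_vars (\<lambda>_. borel)
      (\<lambda>k \<omega>. (\<lambda>f. w k (card {n. n < b k \<and> t < k + f (k, n)}))
        (restrict (\<lambda>i. (case i of (k, n) \<Rightarrow> Y k n) \<omega>) (?K k))) {..<t}"
  proof (rule indep_vars_compose2)
    fix k assume "k \<in> {..<t}"
    have "(\<lambda>f :: nat \<times> nat \<Rightarrow> nat. card {n. n < b k \<and> t < k + f (k, n)}) \<in>
        measurable (PiM (?K k) (\<lambda>_. count_space UNIV)) (count_space UNIV)"
      by (rule measurable_card_lessThan[where P = "\<lambda>y. t < k + y"])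
         (auto intro!: measurable_component_singleton)
    then show "(\<lambda>f. w k (card {n. n < b k \<and> t < k + f (k, n)})) \<in>
        borel_measurable (PiM (?K k) (\<lambda>_. count_space UNIV))"
      by (rule measurable_compose) simp
  qed
  \<comment> \<open>Restricting to the block changes nothing, since only coordinates
    \<open>(k, n)\<close> with \<open>n < b k\<close> are read.\<close>
  also have "(\<lambda>k \<omega>. (\<lambda>f. w k (card {n. n < b k \<and> t < k + f (k, n)}))
        (restrict (\<lambda>i. (case i of (k, n) \<Rightarrow> Y k n) \<omega>) (?K k))) =
      (\<lambda>k \<omega>. w k (card {n. n < b k \<and> t < k + Y k n \<omega>}))"
    by (intro ext arg_cong[where f = "w _"] arg_cong[where f = card]) auto
  finally have "(\<integral>\<^sup>+\<omega>. (\<Prod>k<t. w k (card {n. n < b k \<and> t < k + Y k n \<omega>})) \<partial>M) =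
      (\<Prod>k<t. \<integral>\<^sup>+\<omega>. w k (card {n. n < b k \<and> t < k + Y k n \<omega>}) \<partial>M)"
    by (intro indep_vars_nn_integral) auto
  also have "\<dots> = (\<Prod>k<t. binomial_mean (Phi G (t - k)) (b k) (w k))"
  proof (intro prod.cong refl)
    fix k assume "k \<in> {..<t}"
    \<comment> \<open>The same device with one-point blocks gives independence along row
      \<open>k\<close> of the array.\<close>
    have "indep_vars (\<lambda>n. PiM {(k, n)} (\<lambda>_. count_space UNIV))
        (\<lambda>n \<omega>. restrict (\<lambda>i. (case i of (k, n) \<Rightarrow> Y k n) \<omega>) {(k, n)}) {..<b k}"
      by (rule indep_vars_restrict[OF service_indep]) (auto simp: disjoint_family_on_def)
    then have "indep_vars (\<lambda>_. count_space UNIV)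
        (\<lambda>n \<omega>. (\<lambda>f. f (k, n))
          (restrict (\<lambda>i. (case i of (k, n) \<Rightarrow> Y k n) \<omega>) {(k, n)})) {..<b k}"
      by (rule indep_vars_compose2) (auto intro!: measurable_component_singleton)
    then have "indep_vars (\<lambda>_. count_space UNIV) (Y k) {..<b k}"
      by simp
    from nn_integral_binomial_mean[OF this, of "{y. t < k + y}" "Phi G (t - k)"] prob_service[of k t]
    show "(\<integral>\<^sup>+\<omega>. w k (card {n. n < b k \<and> t < k + Y k n \<omega>}) \<partial>M) =
        binomial_mean (Phi G (t - k)) (b k) (w k)"
      using \<open>k \<in> {..<t}\<close> by simp
  qed
  finally show ?thesis .
qed

text \<open>Translates the independence of the two generated \<sigma>-algebras into a product rule
  for events: one fixes the first \<open>t\<close> batch sizes, the other the value of a countable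
  statistic \<open>K\<close> of the service times.\<close>

lemma arrivals_indep_service:
  fixes K :: "(nat \<times> nat \<Rightarrow> nat) \<Rightarrow> 'c :: countable"
  assumes "K \<in> measurable (PiM UNIV (\<lambda>_. count_space UNIV)) (count_space UNIV)"
  shows "prob ({\<omega>\<in>space M. map (\<lambda>k. B k \<omega>) [0..<t] = bs} \<inter>
             {\<omega>\<in>space M. K (\<lambda>(k, n). Y k n \<omega>) = \<kappa>}) =
         prob {\<omega>\<in>space M. map (\<lambda>k. B k \<omega>) [0..<t] = bs} *
         prob {\<omega>\<in>space M. K (\<lambda>(k, n). Y k n \<omega>) = \<kappa>}"
proof (rule indep_setD[OF service_indep_arrivals])
  let ?A = "Pi\<^sub>M UNIV (\<lambda>_. count_space UNIV) :: (nat \<Rightarrow> nat \<times> nat) measure"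
  let ?S = "Pi\<^sub>M UNIV (\<lambda>_. count_space UNIV) :: (nat \<times> nat \<Rightarrow> nat) measure"
  have "(\<lambda>x. map (\<lambda>k. snd (x k)) [0..<t]) \<in> measurable ?A (count_space UNIV)"
    by (rule measurable_map_upt)
       (auto intro!: measurable_compose[OF measurable_component_singleton])
  from measurable_sets[OF this, of "{bs}"]
  have "(\<lambda>x. map (\<lambda>k. snd (x k)) [0..<t]) -` {bs} \<in> sets ?A"
    by (simp add: space_PiM)
  from in_vimage_algebra[OF this, of "\<lambda>\<omega> k. (I k \<omega>, B k \<omega>)" "space M"]
  show "{\<omega>\<in>space M. map (\<lambda>k. B k \<omega>) [0..<t] = bs} \<in>
      sets (vimage_algebra (space M) (\<lambda>\<omega> k. (I k \<omega>, B k \<omega>)) ?A)"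
    by (simp add: vimage_def Int_def conj_commute)
  have "K -` {\<kappa>} \<in> sets ?S"
    using measurable_sets[OF assms, of "{\<kappa>}"] by (simp add: space_PiM)
  from in_vimage_algebra[OF this, of "\<lambda>\<omega> (k, n). Y k n \<omega>" "space M"]
  show "{\<omega>\<in>space M. K (\<lambda>(k, n). Y k n \<omega>) = \<kappa>} \<in>
      sets (vimage_algebra (space M) (\<lambda>\<omega> (k, n). Y k n \<omega>) ?S)"
    by (simp add: vimage_def Int_def conj_commute)
qed

text \<open>On the event that the batch sizes equal a fixed list, the survivors are a function of
  the service array alone, which is independent of that event. The service times can thus be
  averaged out for fixed batch sizes, and summing over all lists restores the random ones.\<close>

lemma nn_integral_in_service:
  "(\<integral>\<^sup>+\<omega>. (\<Prod>k<t. w k (in_service t k \<omega>)) \<partial>M) =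
     (\<integral>\<^sup>+\<omega>. (\<Prod>k<t. binomial_mean (Phi G (t - k)) (B k \<omega>) (w k)) \<partial>M)"
proof -
  define H where "H \<omega> = map (\<lambda>k. B k \<omega>) [0..<t]" for \<omega>
  have [measurable]: "H \<in> measurable M (count_space UNIV)"
    unfolding H_def by (rule measurable_map_upt) auto
  have *: "(\<integral>\<^sup>+\<omega>. (\<Prod>k<t. w k (in_service t k \<omega>)) * indicator {bs} (H \<omega>) \<partial>M) =
      (\<integral>\<^sup>+\<omega>. (\<Prod>k<t. binomial_mean (Phi G (t - k)) (B k \<omega>) (w k)) * indicator {bs} (H \<omega>) \<partial>M)"
    for bs
  proof -
    \<comment> \<open>Lists \<open>bs\<close> whose length is not \<open>t\<close> are harmless:
      \<open>H\<close> never takes such a value, so both integrals vanish.\<close>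
    define K where
      "K y = map (\<lambda>k. card {n. n < bs ! k \<and> t < k + y (k, n)}) [0..<t]" for y :: "nat \<times> nat \<Rightarrow> nat"
    have K: "K \<in> measurable (PiM UNIV (\<lambda>_. count_space UNIV)) (count_space UNIV)"
      unfolding K_def
      by (intro measurable_map_upt measurable_card_lessThan[where P = "\<lambda>y. t < _ + y"]
            measurable_component_singleton) auto
    have [measurable]: "(\<lambda>\<omega>. K (\<lambda>(k, n). Y k n \<omega>)) \<in> measurable M (count_space UNIV)"
      unfolding K_def
      by (intro measurable_map_upt)
         (auto intro!: measurable_card_lessThan[where P = "\<lambda>y. t < _ + y"])
    have "(\<integral>\<^sup>+\<omega>. (\<Prod>k<t. w k (in_service t k \<omega>)) * indicator {bs} (H \<omega>) \<partial>M) =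
        (\<integral>\<^sup>+\<omega>. (\<Prod>k<t. w k (K (\<lambda>(k, n). Y k n \<omega>) ! k)) *
          indicator {\<omega>\<in>space M. H \<omega> = bs} \<omega> \<partial>M)"
      by (intro nn_integral_cong)
         (auto simp: K_def H_def in_service_def split: split_indicator intro!: prod.cong)
    also have "\<dots> = (\<integral>\<^sup>+\<omega>. (\<Prod>k<t. w k (K (\<lambda>(k, n). Y k n \<omega>) ! k)) \<partial>M) *
        emeasure M {\<omega>\<in>space M. H \<omega> = bs}"
      using arrivals_indep_service[OF K, of t bs]
      by (intro nn_integral_indep_countable[where g = "\<lambda>x. \<Prod>k<t. w k (x ! k)"])
         (auto simp: H_def[symmetric])
    also have "(\<integral>\<^sup>+\<omega>. (\<Prod>k<t. w k (K (\<lambda>(k, n). Y k n \<omega>) ! k)) \<partial>M) =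
        (\<Prod>k<t. binomial_mean (Phi G (t - k)) (bs ! k) (w k))"
      by (simp add: K_def nn_integral_service_batches cong: prod.cong_simp)
    \<comment> \<open>The constant goes back under the integral, where \<open>bs ! k\<close> may be
      read as \<open>B k \<omega>\<close> on the event \<open>H \<omega> = bs\<close>.\<close>
    also have "\<dots> * emeasure M {\<omega>\<in>space M. H \<omega> = bs} =
        (\<integral>\<^sup>+\<omega>. (\<Prod>k<t. binomial_mean (Phi G (t - k)) (bs ! k) (w k)) *
          indicator {\<omega>\<in>space M. H \<omega> = bs} \<omega> \<partial>M)"
      by (simp add: nn_integral_cmult_indicator)
    also have "\<dots> = (\<integral>\<^sup>+\<omega>. (\<Prod>k<t. binomial_mean (Phi G (t - k)) (B k \<omega>) (w k)) *
        indicator {bs} (H \<omega>) \<partial>M)"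
      by (intro nn_integral_cong)
         (auto simp: H_def split: split_indicator intro!: prod.cong)
    finally show ?thesis .
  qed
  show ?thesis
    by (subst (1 2) nn_integral_partition_countable[where H = H]) (simp_all add: *)
qed

section \<open>Stepping along the background chain\<close>

definition history :: "nat \<Rightarrow> 'a \<Rightarrow> (nat \<times> nat) list \<times> nat" where
  "history s \<omega> = (map (\<lambda>k. (I k \<omega>, B k \<omega>)) [0..<s], I s \<omega>)"

lemma history_measurable [measurable]: "history s \<in> measurable M (count_space UNIV)"
proof -
  have *: "(\<lambda>\<omega>. map (\<lambda>k. (I k \<omega>, B k \<omega>)) [0..<s]) \<in> measurable M (count_space UNIV)"
  proof (rule measurable_map_upt)
    show "(\<lambda>\<omega>. (I k \<omega>, B k \<omega>)) \<in> measurable M (count_space UNIV)" for k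
      by (rule measurable_compose_countable[where g = "I k"])
         (auto intro: measurable_compose[OF B_measurable])
  qed
  show ?thesis unfolding history_def
    by (rule measurable_compose_countable[where g = "I s"])
       (auto intro: measurable_compose[OF *])
qed

text \<open>The Markov property in integrated form. The values of \<open>history s\<close> are
  countably many and describe exactly the conditioning events of \<open>transition\<close>, so the
  identity is checked on each of them and summed.\<close>

lemma history_transition:
  assumes "j \<ge> 1"
  shows "(\<integral>\<^sup>+\<omega>. g (history s \<omega>) * indicator {\<omega>. I (Suc s) \<omega> = j \<and> B s \<omega> = l} \<omega> \<partial>M) =
         (\<integral>\<^sup>+\<omega>. g (history s \<omega>) * ennreal (d l (I s \<omega>) j) \<partial>M)"
proof -
  have *: "(\<integral>\<^sup>+\<omega>. g (history s \<omega>) * indicator {\<omega>. I (Suc s) \<omega> = j \<and> B s \<omega> = l} \<omega> *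
        indicator {h} (history s \<omega>) \<partial>M) =
      (\<integral>\<^sup>+\<omega>. g (history s \<omega>) * ennreal (d l (I s \<omega>) j) * indicator {h} (history s \<omega>) \<partial>M)" for h
  proof (cases "\<exists>\<omega>0\<in>space M. history s \<omega>0 = h")
    \<comment> \<open>A sample point \<open>\<omega>0\<close> with this history supplies the
      sequences \<open>h\<close> and \<open>b\<close> required by \<open>transition\<close>. A
      history that never occurs contributes 0 to both sides.\<close>
    case True
    then obtain \<omega>0 where \<omega>0: "\<omega>0 \<in> space M" "history s \<omega>0 = h" by blast
    let ?past = "\<lambda>\<omega>. history s \<omega> = h"
    let ?next = "\<lambda>\<omega>. I (Suc s) \<omega> = j \<and> B s \<omega> = l"
    have h: "?past \<omega> \<longleftrightarrow> (\<forall>r\<le>s. I r \<omega> = I r \<omega>0) \<and> (\<forall>r<s. B r \<omega> = B r \<omega>0)" for \<omega>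
      using \<omega>0 by (auto simp: history_def le_less Ball_def)
    have "prob {\<omega>\<in>space M. ?next \<omega> \<and> ?past \<omega>} = d l (I s \<omega>0) j * prob {\<omega>\<in>space M. ?past \<omega>}"
    proof (cases "prob {\<omega>\<in>space M. ?past \<omega>} > 0")
      case pos: True
      then show ?thesis
        using transition[OF assms pos[unfolded h], of l]
        by (simp add: cond_prob_def h[symmetric] field_simps)
    next
      \<comment> \<open>The conditional probability says nothing about a null event, but there both
        sides are 0.\<close>
      case False
      then have "prob {\<omega>\<in>space M. ?past \<omega>} = 0" by (simp add: less_le)
      moreover have "prob {\<omega>\<in>space M. ?next \<omega> \<and> ?past \<omega>} \<le> prob {\<omega>\<in>space M. ?past \<omega>}"
        by (intro finite_measure_mono) auto
      ultimately show ?thesis by (simp add: measure_le_0_iff)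
    qed
    then have prob_eq: "emeasure M {\<omega>\<in>space M. ?next \<omega> \<and> ?past \<omega>} =
        ennreal (d l (I s \<omega>0) j) * emeasure M {\<omega>\<in>space M. ?past \<omega>}"
      using d_nonneg[OF I_states[OF \<omega>0(1)] assms]
      by (simp add: emeasure_eq_measure ennreal_mult)
    have "(\<integral>\<^sup>+\<omega>. g (history s \<omega>) * indicator {\<omega>. I (Suc s) \<omega> = j \<and> B s \<omega> = l} \<omega> *
        indicator {h} (history s \<omega>) \<partial>M) =
        (\<integral>\<^sup>+\<omega>. g h * indicator {\<omega>\<in>space M. ?next \<omega> \<and> ?past \<omega>} \<omega> \<partial>M)"
      by (intro nn_integral_cong) (auto split: split_indicator)
    also have "\<dots> = g h * ennreal (d l (I s \<omega>0) j) * emeasure M {\<omega>\<in>space M. ?past \<omega>}"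
      by (subst nn_integral_cmult_indicator) (simp_all add: prob_eq[simplified] mult.assoc)
    also have "\<dots> = (\<integral>\<^sup>+\<omega>. g h * ennreal (d l (I s \<omega>0) j) *
        indicator {\<omega>\<in>space M. ?past \<omega>} \<omega> \<partial>M)"
      by (subst nn_integral_cmult_indicator) simp_all
    also have "\<dots> = (\<integral>\<^sup>+\<omega>. g (history s \<omega>) * ennreal (d l (I s \<omega>) j) *
        indicator {h} (history s \<omega>) \<partial>M)"
      using \<omega>0(2) by (intro nn_integral_cong) (auto simp: history_def split: split_indicator)
    finally show ?thesis .
  next
    case False
    then show ?thesis by (intro nn_integral_cong) (auto split: split_indicator)
  qed
  have [measurable]: "(\<lambda>\<omega>. g (history s \<omega>)) \<in> borel_measurable M"
    by (rule measurable_compose[OF history_measurable]) simp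
  have [measurable]: "(\<lambda>\<omega>. ennreal (d l (I s \<omega>) j)) \<in> borel_measurable M"
    by (rule measurable_compose[OF I_measurable]) simp
  have "(\<integral>\<^sup>+\<omega>. g (history s \<omega>) * indicator {\<omega>. I (Suc s) \<omega> = j \<and> B s \<omega> = l} \<omega> \<partial>M) =
      (\<integral>\<^sup>+\<omega>. g (history s \<omega>) * indicator {\<omega>\<in>space M. I (Suc s) \<omega> = j \<and> B s \<omega> = l} \<omega> \<partial>M)"
    by (intro nn_integral_cong) (auto split: split_indicator)
  also have "\<dots> = (\<integral>\<^sup>+h. \<integral>\<^sup>+\<omega>. g (history s \<omega>) *
      indicator {\<omega>\<in>space M. I (Suc s) \<omega> = j \<and> B s \<omega> = l} \<omega> *
        indicator {h} (history s \<omega>) \<partial>M \<partial>count_space UNIV)"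
    by (rule nn_integral_partition_countable) measurable
  also have "\<dots> = (\<integral>\<^sup>+h. \<integral>\<^sup>+\<omega>. g (history s \<omega>) *
      indicator {\<omega>. I (Suc s) \<omega> = j \<and> B s \<omega> = l} \<omega> *
        indicator {h} (history s \<omega>) \<partial>M \<partial>count_space UNIV)"
    by (intro nn_integral_cong) (auto split: split_indicator)
  also have "\<dots> = (\<integral>\<^sup>+\<omega>. g (history s \<omega>) * ennreal (d l (I s \<omega>) j) \<partial>M)"
    unfolding * by (rule nn_integral_partition_countable[symmetric]) measurable
  finally show ?thesis .
qed

text \<open>A discrete Feynman-Kac formula: each transition with batch size \<open>l\<close> carries
  the weight \<open>c k l\<close>, and the row vector collects the weighted mass of paths ending in
  \<open>j\<close>. The induction appends one transition on the right, using Tonelli's theorem and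
  the Markov property.\<close>

lemma vec_mat_prod_eq_nn_integral:
  fixes c :: "nat \<Rightarrow> nat \<Rightarrow> ennreal"
  assumes E: "\<And>k i j. k < s \<Longrightarrow> i \<ge> 1 \<Longrightarrow> j \<ge> 1 \<Longrightarrow>
      E k i j = (\<integral>\<^sup>+l. ennreal (d l i j) * c k l \<partial>count_space UNIV)"
    and j: "j \<ge> 1"
  shows "vec_mat (init_dist M I) (mat_prod E s) j =
           (\<integral>\<^sup>+\<omega>. (\<Prod>k<s. c k (B k \<omega>)) * indicator {j} (I s \<omega>) \<partial>M)"
  using E j
proof (induction s arbitrary: j)
  case 0
  have "(\<integral>\<^sup>+\<omega>. indicator {j} (I 0 \<omega>) \<partial>M) = (\<integral>\<^sup>+\<omega>. indicator {\<omega>\<in>space M. I 0 \<omega> = j} \<omega> \<partial>M)"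
    by (intro nn_integral_cong) (auto split: split_indicator)
  with 0 show ?case by (simp add: vec_mat_mat_id init_dist_def)
next
  case (Suc s)
  define P where "P \<omega> = (\<Prod>k<s. c k (B k \<omega>))" for \<omega>
  have [measurable]: "(\<lambda>\<omega>. c k (B k \<omega>)) \<in> borel_measurable M" for k
    by (rule measurable_compose[OF B_measurable]) simp
  have [measurable]: "P \<in> borel_measurable M" unfolding P_def by measurable
  have [measurable]: "(\<lambda>\<omega>. indicator {i} (I s' \<omega>) :: ennreal) \<in> borel_measurable M" for i s'
    by (rule measurable_compose[OF I_measurable]) simp
  have [measurable]: "(\<lambda>\<omega>. indicator {i} (B s' \<omega>) :: ennreal) \<in> borel_measurable M" for i s'
    by (rule measurable_compose[OF B_measurable]) simp
  have [measurable]: "(\<lambda>\<omega>. ennreal (d l (I s \<omega>) j)) \<in> borel_measurable M" for l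
    by (rule measurable_compose[OF I_measurable]) simp
  \<comment> \<open>The accumulated weight depends on the history only, so it may serve as
    \<open>g\<close> in \<open>history_transition\<close>.\<close>
  have P_hist: "P \<omega> = (\<Prod>k<s. c k (snd (fst (history s \<omega>) ! k)))" for \<omega>
    by (simp add: P_def history_def)
  have "vec_mat (init_dist M I) (mat_prod E (Suc s)) j =
      (\<integral>\<^sup>+i. (\<integral>\<^sup>+\<omega>. P \<omega> * indicator {i} (I s \<omega>) \<partial>M) *
        (\<integral>\<^sup>+l. ennreal (d l i j) * c s l \<partial>count_space UNIV) \<partial>count_space {1..})"
    using Suc unfolding mat_prod.simps vec_mat_mat_mult
    by (subst vec_mat_def) (auto simp: infsum_conv_nn_integral P_def intro!: nn_integral_cong)
  \<comment> \<open>On \<open>I s \<omega> = i\<close> the factor \<open>d l i j\<close> equals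
    \<open>d l (I s \<omega>) j\<close>. In that form it no longer mentions \<open>i\<close>, and
    the sum over \<open>i\<close> can be absorbed next.\<close>
  also have "\<dots> = (\<integral>\<^sup>+i. \<integral>\<^sup>+l. c s l *
      (\<integral>\<^sup>+\<omega>. P \<omega> * indicator {i} (I s \<omega>) * ennreal (d l (I s \<omega>) j) \<partial>M)
        \<partial>count_space UNIV \<partial>count_space {1..})"
  proof (intro nn_integral_cong)
    fix i
    have "(\<integral>\<^sup>+\<omega>. P \<omega> * indicator {i} (I s \<omega>) * ennreal (d l (I s \<omega>) j) \<partial>M) =
        (\<integral>\<^sup>+\<omega>. P \<omega> * indicator {i} (I s \<omega>) \<partial>M) * ennreal (d l i j)" for l
      by (subst nn_integral_multc[symmetric])
         (auto intro!: nn_integral_cong split: split_indicator)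
    then show "(\<integral>\<^sup>+\<omega>. P \<omega> * indicator {i} (I s \<omega>) \<partial>M) *
        (\<integral>\<^sup>+l. ennreal (d l i j) * c s l \<partial>count_space UNIV) =
        (\<integral>\<^sup>+l. c s l * (\<integral>\<^sup>+\<omega>. P \<omega> * indicator {i} (I s \<omega>) * ennreal (d l (I s \<omega>) j) \<partial>M)
          \<partial>count_space UNIV)"
      by (simp add: mult_ac flip: nn_integral_cmult)
  qed
  also have "\<dots> = (\<integral>\<^sup>+l. c s l * (\<integral>\<^sup>+i.
      (\<integral>\<^sup>+\<omega>. P \<omega> * indicator {i} (I s \<omega>) * ennreal (d l (I s \<omega>) j) \<partial>M)
        \<partial>count_space {1..}) \<partial>count_space UNIV)"
    by (subst nn_integral_count_space_nn_integral) (auto simp: nn_integral_cmult)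
  also have "\<dots> = (\<integral>\<^sup>+l. c s l * (\<integral>\<^sup>+\<omega>. P \<omega> * ennreal (d l (I s \<omega>) j) \<partial>M) \<partial>count_space UNIV)"
  proof (intro nn_integral_cong arg_cong[where f = "(*) _"])
    fix l
    have "(\<integral>\<^sup>+i. (\<integral>\<^sup>+\<omega>. P \<omega> * indicator {i} (I s \<omega>) * ennreal (d l (I s \<omega>) j) \<partial>M)
        \<partial>count_space {1..}) =
        (\<integral>\<^sup>+\<omega>. \<integral>\<^sup>+i. P \<omega> * indicator {i} (I s \<omega>) * ennreal (d l (I s \<omega>) j)
          \<partial>count_space {1..} \<partial>M)"
      by (rule nn_integral_count_space_nn_integral[symmetric]) auto
    also have "\<dots> = (\<integral>\<^sup>+\<omega>. P \<omega> * ennreal (d l (I s \<omega>) j) \<partial>M)"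
    proof (intro nn_integral_cong)
      fix \<omega> assume "\<omega> \<in> space M"
      then show "(\<integral>\<^sup>+i. P \<omega> * indicator {i} (I s \<omega>) * ennreal (d l (I s \<omega>) j)
          \<partial>count_space {1..}) = P \<omega> * ennreal (d l (I s \<omega>) j)"
        \<comment> \<open>States are at least 1, so exactly one index in \<open>{1..}\<close> hits
          \<open>I s \<omega>\<close>.\<close>
        using I_states[of \<omega> s] by (subst nn_integral_count_space'[where A = "{I s \<omega>}"]) auto
    qed
    finally show "(\<integral>\<^sup>+i. (\<integral>\<^sup>+\<omega>. P \<omega> * indicator {i} (I s \<omega>) * ennreal (d l (I s \<omega>) j) \<partial>M)
        \<partial>count_space {1..}) = (\<integral>\<^sup>+\<omega>. P \<omega> * ennreal (d l (I s \<omega>) j) \<partial>M)" .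
  qed
  also have "\<dots> = (\<integral>\<^sup>+l. c s l *
      (\<integral>\<^sup>+\<omega>. P \<omega> * indicator {\<omega>. I (Suc s) \<omega> = j \<and> B s \<omega> = l} \<omega> \<partial>M) \<partial>count_space UNIV)"
    unfolding P_hist
    by (subst history_transition[OF Suc.prems(2),
          where g = "\<lambda>h. \<Prod>k<s. c k (snd (fst h ! k))"]) (rule refl)
  also have "\<dots> = (\<integral>\<^sup>+l. \<integral>\<^sup>+\<omega>. P \<omega> * c s (B s \<omega>) * indicator {j} (I (Suc s) \<omega>) *
      indicator {l} (B s \<omega>) \<partial>M \<partial>count_space UNIV)"
  proof (intro nn_integral_cong)
    fix l
    have "(\<integral>\<^sup>+\<omega>. P \<omega> * indicator {\<omega>. I (Suc s) \<omega> = j \<and> B s \<omega> = l} \<omega> \<partial>M) =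
        (\<integral>\<^sup>+\<omega>. P \<omega> * indicator {j} (I (Suc s) \<omega>) * indicator {l} (B s \<omega>) \<partial>M)"
      by (intro nn_integral_cong) (auto split: split_indicator)
    then have "c s l * (\<integral>\<^sup>+\<omega>. P \<omega> * indicator {\<omega>. I (Suc s) \<omega> = j \<and> B s \<omega> = l} \<omega> \<partial>M) =
        (\<integral>\<^sup>+\<omega>. c s l * (P \<omega> * indicator {j} (I (Suc s) \<omega>) * indicator {l} (B s \<omega>)) \<partial>M)"
      by (simp add: nn_integral_cmult)
    also have "\<dots> = (\<integral>\<^sup>+\<omega>. P \<omega> * c s (B s \<omega>) * indicator {j} (I (Suc s) \<omega>) *
      indicator {l} (B s \<omega>) \<partial>M)"
      by (intro nn_integral_cong) (auto split: split_indicator simp: mult_ac)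
    finally show "c s l * (\<integral>\<^sup>+\<omega>. P \<omega> * indicator {\<omega>. I (Suc s) \<omega> = j \<and> B s \<omega> = l} \<omega> \<partial>M) =
        (\<integral>\<^sup>+\<omega>. P \<omega> * c s (B s \<omega>) * indicator {j} (I (Suc s) \<omega>) * indicator {l} (B s \<omega>) \<partial>M)" .
  qed
  also have "\<dots> = (\<integral>\<^sup>+\<omega>. P \<omega> * c s (B s \<omega>) * indicator {j} (I (Suc s) \<omega>) \<partial>M)"
    by (rule nn_integral_partition_countable[symmetric]) measurable
  finally show ?case by (simp add: P_def)
qed

lemma vec_dot_mat_prod_eq_nn_integral:
  fixes c :: "nat \<Rightarrow> nat \<Rightarrow> ennreal"
  assumes "\<And>k i j. k < t \<Longrightarrow> i \<ge> 1 \<Longrightarrow> j \<ge> 1 \<Longrightarrow>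
      E k i j = (\<integral>\<^sup>+l. ennreal (d l i j) * c k l \<partial>count_space UNIV)"
  shows "vec_dot (vec_mat (init_dist M I) (mat_prod E t)) ones = (\<integral>\<^sup>+\<omega>. (\<Prod>k<t. c k (B k \<omega>)) \<partial>M)"
proof -
  have [measurable]: "(\<lambda>\<omega>. c k (B k \<omega>)) \<in> borel_measurable M" for k
    by (rule measurable_compose[OF B_measurable]) simp
  have [measurable]: "(\<lambda>\<omega>. indicator {j} (I t \<omega>) :: ennreal) \<in> borel_measurable M" for j
    by (rule measurable_compose[OF I_measurable]) simp
  have "vec_dot (vec_mat (init_dist M I) (mat_prod E t)) ones =
      (\<integral>\<^sup>+j. (\<integral>\<^sup>+\<omega>. (\<Prod>k<t. c k (B k \<omega>)) * indicator {j} (I t \<omega>) \<partial>M) \<partial>count_space {1..})"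
    using vec_mat_prod_eq_nn_integral[OF assms]
    by (auto simp: vec_dot_def ones_def infsum_conv_nn_integral intro!: nn_integral_cong)
  also have "\<dots> = (\<integral>\<^sup>+\<omega>. (\<integral>\<^sup>+j. (\<Prod>k<t. c k (B k \<omega>)) * indicator {j} (I t \<omega>) \<partial>count_space {1..}) \<partial>M)"
    by (rule nn_integral_count_space_nn_integral[symmetric]) auto
  also have "\<dots> = (\<integral>\<^sup>+\<omega>. (\<Prod>k<t. c k (B k \<omega>)) \<partial>M)"
  proof (intro nn_integral_cong)
    fix \<omega> assume "\<omega> \<in> space M"
    then show "(\<integral>\<^sup>+j. (\<Prod>k<t. c k (B k \<omega>)) * indicator {j} (I t \<omega>) \<partial>count_space {1..}) =
        (\<Prod>k<t. c k (B k \<omega>))"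
      using I_states[of \<omega> t] by (subst nn_integral_count_space'[where A = "{I t \<omega>}"]) auto
  qed
  finally show ?thesis .
qed

section \<open>Derivative matrices and the two composition formulas\<close>

lemma scaled_D_deriv:
  assumes "0 \<le> p" "0 \<le> x" "i \<ge> 1" "j \<ge> 1"
  shows "mat_scale (ennreal (p ^ l)) (D_deriv d l x) i j =
    (\<integral>\<^sup>+r. ennreal (d r i j) * ennreal (real (falling r l) * p ^ l * x ^ (r - l)) \<partial>count_space UNIV)"
proof -
  have "mat_scale (ennreal (p ^ l)) (D_deriv d l x) i j =
      (\<integral>\<^sup>+r. ennreal (d r i j) * ennreal (real (falling r l) * p ^ l * x ^ (r - l)) \<partial>count_space {l..})"
    using assms d_nonneg
    by (auto simp: mat_scale_def D_deriv_def infsum_conv_nn_integral mult_ac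
        simp flip: nn_integral_cmult ennreal_mult intro!: nn_integral_cong)
  also have "\<dots> = (\<integral>\<^sup>+r. ennreal (d r i j) *
      ennreal (real (falling r l) * p ^ l * x ^ (r - l)) \<partial>count_space UNIV)"
    \<comment> \<open>The terms with \<open>r < l\<close> may be added because
      \<open>falling r l\<close> vanishes there.\<close>
    by (rule nn_integral_count_space_eq) (auto simp: falling_conv_choose binomial_eq_0)
  finally show ?thesis .
qed

lemma num_dist_eq_nn_integral:
  "num_dist M B Y m t = (\<integral>\<^sup>+\<omega>. (if num_customers B Y t \<omega> = m then 1 else 0) \<partial>M)"
proof -
  have "(\<integral>\<^sup>+\<omega>. (if num_customers B Y t \<omega> = m then 1 else 0) \<partial>M) =
      (\<integral>\<^sup>+\<omega>. indicator {\<omega>\<in>space M. num_customers B Y t \<omega> = m} \<omega> \<partial>M)"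
    by (intro nn_integral_cong) (auto split: split_indicator)
  then show ?thesis by (simp add: num_dist_def)
qed

lemma factorial_moment_eq_nn_integral:
  "factorial_moment M B Y k t = (\<integral>\<^sup>+\<omega>. of_nat (falling (num_customers B Y t \<omega>) k) \<partial>M)"
proof -
  have [measurable]: "(\<lambda>\<omega>. of_nat (falling (num_customers B Y t \<omega>) k) :: ennreal) \<in> borel_measurable M"
    by (rule measurable_compose[OF num_customers_measurable]) simp
  have "(\<integral>\<^sup>+\<omega>. of_nat (falling (num_customers B Y t \<omega>) k) \<partial>M) =
      (\<integral>\<^sup>+m. \<integral>\<^sup>+\<omega>. of_nat (falling (num_customers B Y t \<omega>) k) *
        indicator {m} (num_customers B Y t \<omega>) \<partial>M \<partial>count_space UNIV)"
    by (rule nn_integral_partition_countable) measurable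
  also have "\<dots> = (\<integral>\<^sup>+m. of_nat (falling m k) * num_dist M B Y m t \<partial>count_space UNIV)"
  proof (intro nn_integral_cong)
    fix m
    have "(\<integral>\<^sup>+\<omega>. of_nat (falling (num_customers B Y t \<omega>) k) *
        indicator {m} (num_customers B Y t \<omega>) \<partial>M) =
        (\<integral>\<^sup>+\<omega>. of_nat (falling m k) * indicator {\<omega>\<in>space M. num_customers B Y t \<omega> = m} \<omega> \<partial>M)"
      by (intro nn_integral_cong) (auto split: split_indicator)
    then show "(\<integral>\<^sup>+\<omega>. of_nat (falling (num_customers B Y t \<omega>) k) *
        indicator {m} (num_customers B Y t \<omega>) \<partial>M) = of_nat (falling m k) * num_dist M B Y m t"
      by (simp add: nn_integral_cmult_indicator num_dist_def)
  qed
  finally show ?thesis by (simp add: factorial_moment_def infsum_conv_nn_integral)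
qed

text \<open>The common core of both formulas. The family \<open>w\<close> of weights is left open;
  all that is asked of \<open>E k l\<close> is that its entries average \<open>w l\<close> over the
  survivors of batch \<open>k\<close>.\<close>

lemma nn_integral_in_service_compositions:
  assumes "\<And>k l i j. k < t \<Longrightarrow> i \<ge> 1 \<Longrightarrow> j \<ge> 1 \<Longrightarrow> E k l i j =
      (\<integral>\<^sup>+r. ennreal (d r i j) * binomial_mean (Phi G (t - k)) r (w l) \<partial>count_space UNIV)"
  shows "(\<integral>\<^sup>+\<omega>. (\<Sum>l\<in>compositions t m. a l * (\<Prod>k<t. w (l k) (in_service t k \<omega>))) \<partial>M) =
    vec_dot (vec_mat (init_dist M I)
      (mat_sum (\<lambda>l. mat_scale (a l) (mat_prod (\<lambda>k. E k (l k)) t)) (compositions t m))) ones"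
proof -
  have [measurable]: "(\<lambda>\<omega>. w l (in_service t k \<omega>)) \<in> borel_measurable M" for k l
    by (rule measurable_compose[OF in_service_measurable]) simp
  have "(\<integral>\<^sup>+\<omega>. (\<Prod>k<t. w (l k) (in_service t k \<omega>)) \<partial>M) =
      vec_dot (vec_mat (init_dist M I) (mat_prod (\<lambda>k. E k (l k)) t)) ones" for l
    unfolding nn_integral_in_service[where w = "\<lambda>k. w (l k)"]
    by (rule vec_dot_mat_prod_eq_nn_integral[symmetric]) (rule assms)
  then show ?thesis
    by (simp add: vec_dot_mat_sum nn_integral_sum nn_integral_cmult)
qed

end

theorem mainTheorem2:
  fixes M :: "'a measure"
    and d :: "nat \<Rightarrow> nat \<Rightarrow> nat \<Rightarrow> real"
    and G :: "nat pmf"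
    and I :: "nat \<Rightarrow> 'a \<Rightarrow> nat"
    and B :: "nat \<Rightarrow> 'a \<Rightarrow> nat"
    and Y :: "nat \<Rightarrow> nat \<Rightarrow> 'a \<Rightarrow> nat"
    and t :: nat
  assumes "dbmap_g_infinity_queue M d G I B Y"
    and "t \<ge> 1"
  shows "(\<forall>m::nat. num_dist M B Y m t =
            ennreal (1 / fact m) *
            vec_dot (vec_mat (init_dist M I)
              (mat_sum (\<lambda>l. mat_scale (multinomial_coeff t m l)
                 (mat_prod (\<lambda>i. mat_scale (ennreal (Phi G (t - i) ^ l i))
                                 (D_deriv d (l i) (1 - Phi G (t - i)))) t))
                 (compositions t m))) ones) \<and>
         (\<forall>k::nat. k \<ge> 1 \<longrightarrow> factorial_moment M B Y k t =
            vec_dot (vec_mat (init_dist M I)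
              (mat_sum (\<lambda>l. mat_scale (multinomial_coeff t k l)
                 (mat_prod (\<lambda>i. mat_scale (ennreal (Phi G (t - i) ^ l i))
                                 (D_deriv d (l i) 1)) t))
                 (compositions t k))) ones)"
proof -
  interpret dbmap_g_infinity_queue M d G I B Y by fact
  have Phi: "0 \<le> Phi G n" "Phi G n \<le> 1" for n
    by (simp_all add: Phi_def)
  have "num_dist M B Y m t = ennreal (1 / fact m) *
      vec_dot (vec_mat (init_dist M I)
        (mat_sum (\<lambda>l. mat_scale (multinomial_coeff t m l)
           (mat_prod (\<lambda>i. mat_scale (ennreal (Phi G (t - i) ^ l i))
                           (D_deriv d (l i) (1 - Phi G (t - i)))) t))
           (compositions t m))) ones" for m
  proof -
    \<comment> \<open>The value \<open>fact l\<close> makes the binomial mean equal the coefficient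
      in \<open>p ^ l\<close> times the \<open>l\<close>-th derivative at \<open>1 - p\<close>; the
      prefactor \<open>1 / fact m\<close> compensates for it.\<close>
    let ?w = "\<lambda>l n. if n = l then fact l else 0 :: ennreal"
    have [measurable]: "(\<lambda>\<omega>. ?w l (in_service t k \<omega>)) \<in> borel_measurable M" for k l
      by (rule measurable_compose[OF in_service_measurable]) simp
    have "num_dist M B Y m t = ennreal (1 / fact m) * (\<integral>\<^sup>+\<omega>.
        (\<Sum>l\<in>compositions t m. multinomial_coeff t m l * (\<Prod>k<t. ?w (l k) (in_service t k \<omega>))) \<partial>M)"
      unfolding num_dist_eq_nn_integral num_customers_eq indicator_sum_compositions
      by (subst nn_integral_cmult) auto
    then show ?thesis
      using Phi
      by (subst (asm) nn_integral_in_service_compositions[where E = "\<lambda>k l.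
            mat_scale (ennreal (Phi G (t - k) ^ l)) (D_deriv d l (1 - Phi G (t - k)))"])
         (simp_all add: scaled_D_deriv binomial_mean_indicator)
  qed
  moreover have "factorial_moment M B Y k t = vec_dot (vec_mat (init_dist M I)
      (mat_sum (\<lambda>l. mat_scale (multinomial_coeff t k l)
         (mat_prod (\<lambda>i. mat_scale (ennreal (Phi G (t - i) ^ l i)) (D_deriv d (l i) 1)) t))
         (compositions t k))) ones" for k
    \<comment> \<open>The binomial mean of a falling factorial has no factor \<open>1 - p\<close>,
      which is why the derivatives are taken at 1.\<close>
    unfolding factorial_moment_eq_nn_integral num_customers_eq falling_sum_compositions
    by (rule nn_integral_in_service_compositions[where w = "\<lambda>l n. of_nat (falling n l)"
          and E = "\<lambda>k l. mat_scale (ennreal (Phi G (t - k) ^ l)) (D_deriv d l 1)"])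
       (simp add: scaled_D_deriv binomial_mean_falling Phi)
  ultimately show ?thesis by blast
qed

end
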